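(* Let $H$ be an algebraic group over an algebraically closed field $k$ of characteristic $0$ such that, for every group $\Gamma$, sending $\rho:\Gamma\to H(k)$ to the FFG-algebra morphism $\Theta_\rho^\bullet$ given by $\Theta_\rho^{\{1,\dots,n\}}(f)(\gamma_1,\dots,\gamma_n)=f(\rho(\gamma_1),\dots,\rho(\gamma_n))$ defines a bijection between the set of $H(k)$-conjugacy classes of semisimple representations $\rho:\Gamma\to H(k)$ and the set of FFG-algebra morphisms $k[H^\bullet]^{\mathrm{Ad}\,H}\to\mathrm{Map}(\Gamma^\bullet/\mathrm{Ad}\,\Gamma,k)$ (this holds e.g. if $H$ is connected reductive). Suppose that $k[H^\bullet]^{\mathrm{Ad}\,H}$ is generated by $k[H]^{\mathrm{Ad}\,H}$ as an FFG-algebra. Then $H(k)$ is acceptable.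
   Context: FFG is the category of free groups $\mathrm{FG}(I)$ on finite nonempty sets $I$, with group homomorphisms. An FFG-algebra over $k$ is a functor $A^\bullet$ from FFG to (commutative) $k$-algebras; $A^I$ is its value at $\mathrm{FG}(I)$. Morphisms are natural transformations. $A^\bullet$ is generated by a subset $\Sigma\subset\bigsqcup_IA^I$ if $A^\bullet$ is the smallest sub-FFG-algebra of itself containing $\Sigma$. $k[H^\bullet]^{\mathrm{Ad}\,H}$ is the FFG-algebra $I\mapsto k[H^I]^{\mathrm{Ad}\,H}$ of regular functions on $H^I$ invariant under simultaneous conjugation by $H$; a homomorphism $\phi:\mathrm{FG}(I)\to\mathrm{FG}(J)$ acts by pullback along the induced map $H^J=\mathrm{Hom}(\mathrm{FG}(J),H)\to\mathrm{Hom}(\mathrm{FG}(I),H)=H^I$. $k[H]^{\mathrm{Ad}\,H}$ is its value at a one-element set. $\mathrm{Map}(\Gamma^\bullet/\mathrm{Ad}\,\Gamma,k)$ is the FFG-algebra $I\mapsto$ set maps $\Gamma^I\to k$ invariant under diagonal conjugation by $\Gamma$, with $\phi$ acting by pullback along $\Gamma^J=\mathrm{Hom}(\mathrm{FG}(J),\Gamma)\to\Gamma^I$. A representation is a group homomorphism; it is semisimple if the Zariski closure of its image is reductive. Homomorphisms $\rho_1,\rho_2:\Gamma\to H(k)$ are globally conjugate if there is $h\in H(k)$ with $\rho_1=h\rho_2h^{-1}$, and element-conjugate if for every $\gamma\in\Gamma$ there is $h_\gamma\in H(k)$ with $\rho_1(\gamma)=h_\gamma\rho_2(\gamma)h_\gamma^{-1}$.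 $H(k)$ is acceptable if, for every group $\Gamma$, any two element-conjugate semisimple representations $\Gamma\to H(k)$ are globally conjugate. *)

theory Defs
  imports "HOL-Algebra.Subrings" "HOL-Algebra.Module" "HOL-Algebra.Coset"
    "HOL-Computational_Algebra.Polynomial" "HOL-Analysis.Abstract_Topology"
begin

section \<open>Algebras over a field, algebras of functions\<close>

definition base_algebra :: "('k::field, 'k) module"
  where "base_algebra = \<lparr>carrier = UNIV, monoid.mult = (*), one = 1, zero = 0, add = (+), module.smult = (*)\<rparr>"

text \<open>A commutative algebra over the field \<open>'k\<close> is a structure \<open>M\<close> with
  \<open>algebra base_algebra M\<close>.\<close>

definition kalg_hom :: "('k::field, 'a, 'm) module_scheme \<Rightarrow> ('k, 'b, 'n) module_scheme \<Rightarrow> ('a \<Rightarrow> 'b) set"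
  where "kalg_hom M N = {h \<in> ring_hom M N \<inter> extensional (carrier M).
           \<forall>c. \<forall>x\<in>carrier M. h (c \<odot>\<^bsub>M\<^esub> x) = c \<odot>\<^bsub>N\<^esub> h x}"

definition ksubalgebra :: "'a set \<Rightarrow> ('k::field, 'a, 'm) module_scheme \<Rightarrow> bool"
  where "ksubalgebra B M \<longleftrightarrow> subring B M \<and> (\<forall>c. \<forall>b\<in>B. c \<odot>\<^bsub>M\<^esub> b \<in> B)"

text \<open>A function on the set \<open>D\<close> is a total function that is \<open>undefined\<close> outside \<open>D\<close>.\<close>

definition fun_algebra :: "'x set \<Rightarrow> ('x \<Rightarrow> 'k) set \<Rightarrow> ('k::field, 'x \<Rightarrow> 'k) module"
  where "fun_algebra D F = \<lparr>carrier = F,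
     monoid.mult = (\<lambda>f g. \<lambda>x\<in>D. f x * g x), one = (\<lambda>x\<in>D. 1),
     zero = (\<lambda>x\<in>D. 0), add = (\<lambda>f g. \<lambda>x\<in>D. f x + g x),
     module.smult = (\<lambda>c f. \<lambda>x\<in>D. c * f x)\<rparr>"

definition gen_funs :: "'x set \<Rightarrow> ('x \<Rightarrow> 'k::field) set \<Rightarrow> ('x \<Rightarrow> 'k) set"
  where "gen_funs D S = \<Inter>{B. ksubalgebra B (fun_algebra D (extensional D)) \<and> S \<subseteq> B}"


section \<open>Free groups\<close>

text \<open>The letter \<open>(i, True)\<close> stands for the generator \<open>i\<close>, and \<open>(i, False)\<close> for its inverse.\<close>

type_synonym 'i word = "('i \<times> bool) list"

definition cancels :: "'i \<times> bool \<Rightarrow> 'i \<times> bool \<Rightarrow> bool"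
  where "cancels a b \<longleftrightarrow> fst a = fst b \<and> snd a \<noteq> snd b"

definition reduced :: "'i word \<Rightarrow> bool"
  where "reduced = successively (\<lambda>a b. \<not> cancels a b)"

fun push :: "'i \<times> bool \<Rightarrow> 'i word \<Rightarrow> 'i word" where
  "push a [] = [a]"
| "push a (b # w) = (if cancels a b then w else a # b # w)"

definition free_group :: "'i set \<Rightarrow> 'i word monoid"
  where "free_group I = \<lparr>carrier = {w. reduced w \<and> fst ` set w \<subseteq> I}, monoid.mult = foldr push, one = []\<rparr>"

definition free_gen :: "'i \<Rightarrow> 'i word"
  where "free_gen i = [(i, True)]"

fun word_eval :: "('g, 'm) monoid_scheme \<Rightarrow> ('i \<Rightarrow> 'g) \<Rightarrow> 'i word \<Rightarrow> 'g" where
  "word_eval G x [] = \<one>\<^bsub>G\<^esub>"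
| "word_eval G x (a # w) = (if snd a then x (fst a) else inv\<^bsub>G\<^esub> x (fst a)) \<otimes>\<^bsub>G\<^esub> word_eval G x w"

text \<open>The identification of \<open>G\<^sup>J\<close> with the homomorphisms from \<open>FG(J)\<close> to \<open>G\<close> sends a
  tuple \<open>x\<close> to \<open>word_eval G x\<close>; this is the unique homomorphism taking each generator \<open>j\<close> to
  \<open>x j\<close> (lemmas \<open>word_eval_hom\<close>, \<open>word_eval_unique\<close> below). Under it, composition with
  \<open>\<phi> : FG(I) \<rightarrow> FG(J)\<close> becomes the following map \<open>G\<^sup>J \<rightarrow> G\<^sup>I\<close>.\<close>

definition tuple_map :: "('g, 'm) monoid_scheme \<Rightarrow> 'i set \<Rightarrow> ('i word \<Rightarrow> 'j word) \<Rightarrow> ('j \<Rightarrow> 'g) \<Rightarrow> 'i \<Rightarrow> 'g"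
  where "tuple_map G I \<phi> x = (\<lambda>i\<in>I. word_eval G x (\<phi> (free_gen i)))"


section \<open>FFG-algebras\<close>

text \<open>The category FFG is represented by its equivalent full subcategory on the free groups on
  finite nonempty sets of natural numbers.\<close>

definition ffg_obj :: "nat set set"
  where "ffg_obj = {I. finite I \<and> I \<noteq> {}}"

definition ffg_arr :: "nat set \<Rightarrow> nat set \<Rightarrow> (nat word \<Rightarrow> nat word) set"
  where "ffg_arr I J = hom (free_group I) (free_group J) \<inter> extensional (carrier (free_group I))"

record ('k, 'a) ffg_data =
  ffg_val :: "nat set \<Rightarrow> ('k, 'a) module"
  ffg_map :: "nat set \<Rightarrow> nat set \<Rightarrow> (nat word \<Rightarrow> nat word) \<Rightarrow> 'a \<Rightarrow> 'a"

locale ffg_algebra =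
  fixes A :: "('k::field, 'a) ffg_data"
  assumes val: "I \<in> ffg_obj \<Longrightarrow> algebra (base_algebra :: ('k, 'k) module) (ffg_val A I)"
    and map: "\<lbrakk>I \<in> ffg_obj; J \<in> ffg_obj; \<phi> \<in> ffg_arr I J\<rbrakk>
      \<Longrightarrow> ffg_map A I J \<phi> \<in> kalg_hom (ffg_val A I) (ffg_val A J)"
    and map_id: "\<lbrakk>I \<in> ffg_obj; a \<in> carrier (ffg_val A I)\<rbrakk>
      \<Longrightarrow> ffg_map A I I (\<lambda>w\<in>carrier (free_group I). w) a = a"
    and map_comp: "\<lbrakk>I \<in> ffg_obj; J \<in> ffg_obj; K \<in> ffg_obj; \<phi> \<in> ffg_arr I J; \<psi> \<in> ffg_arr J K;
        a \<in> carrier (ffg_val A I)\<rbrakk>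
      \<Longrightarrow> ffg_map A I K (compose (carrier (free_group I)) \<psi> \<phi>) a
          = ffg_map A J K \<psi> (ffg_map A I J \<phi> a)"

definition ffg_hom :: "('k::field, 'a) ffg_data \<Rightarrow> ('k, 'b) ffg_data \<Rightarrow> (nat set \<Rightarrow> 'a \<Rightarrow> 'b) set"
  where "ffg_hom A B = {\<eta> \<in> extensional ffg_obj.
     (\<forall>I\<in>ffg_obj. \<eta> I \<in> kalg_hom (ffg_val A I) (ffg_val B I)) \<and>
     (\<forall>I\<in>ffg_obj. \<forall>J\<in>ffg_obj. \<forall>\<phi>\<in>ffg_arr I J. \<forall>a\<in>carrier (ffg_val A I).
        \<eta> J (ffg_map A I J \<phi> a) = ffg_map B I J \<phi> (\<eta> I a))}"

definition sub_ffg_algebra :: "(nat set \<Rightarrow> 'a set) \<Rightarrow> ('k::field, 'a) ffg_data \<Rightarrow> bool"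
  where "sub_ffg_algebra S A \<longleftrightarrow>
     (\<forall>I\<in>ffg_obj. ksubalgebra (S I) (ffg_val A I)) \<and>
     (\<forall>I\<in>ffg_obj. \<forall>J\<in>ffg_obj. \<forall>\<phi>\<in>ffg_arr I J. ffg_map A I J \<phi> ` S I \<subseteq> S J)"

text \<open>\<open>\<Sigma>\<close> is a subset of the disjoint union of the values of \<open>A\<close>, i.e. a set of pairs \<open>(I, a)\<close>.\<close>

definition ffg_generated_by :: "('k::field, 'a) ffg_data \<Rightarrow> (nat set \<times> 'a) set \<Rightarrow> bool"
  where "ffg_generated_by A \<Sigma> \<longleftrightarrow>
     \<Sigma> \<subseteq> (SIGMA I:ffg_obj. carrier (ffg_val A I)) \<and>
     (\<forall>S. sub_ffg_algebra S A \<and> \<Sigma> \<subseteq> (SIGMA I:ffg_obj. S I)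
        \<longrightarrow> (\<forall>I\<in>ffg_obj. S I = carrier (ffg_val A I)))"

text \<open>FFG-algebras of functions on the powers of a group that are invariant under simultaneous
  conjugation; \<open>F I\<close> is the set of all functions on \<open>G\<^sup>I\<close> that are allowed.\<close>

definition conj_invariant :: "('g, 'm) monoid_scheme \<Rightarrow> 'i set \<Rightarrow> (('i \<Rightarrow> 'g) \<Rightarrow> 'k) \<Rightarrow> bool"
  where "conj_invariant G I f \<longleftrightarrow> (\<forall>g\<in>carrier G. \<forall>x \<in> I \<rightarrow>\<^sub>E carrier G.
     f (\<lambda>i\<in>I. g \<otimes>\<^bsub>G\<^esub> x i \<otimes>\<^bsub>G\<^esub> inv\<^bsub>G\<^esub> g) = f x)"

definition inv_fun_ffg :: "('g, 'm) monoid_scheme \<Rightarrow> (nat set \<Rightarrow> ((nat \<Rightarrow> 'g) \<Rightarrow> 'k) set)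
    \<Rightarrow> ('k::field, (nat \<Rightarrow> 'g) \<Rightarrow> 'k) ffg_data"
  where "inv_fun_ffg G F = \<lparr>
     ffg_val = (\<lambda>I. fun_algebra (I \<rightarrow>\<^sub>E carrier G) {f \<in> F I. conj_invariant G I f}),
     ffg_map = (\<lambda>I J \<phi>. \<lambda>f\<in>{f \<in> F I. conj_invariant G I f}. \<lambda>x\<in>J \<rightarrow>\<^sub>E carrier G. f (tuple_map G I \<phi> x))\<rparr>"

definition map_ffg :: "('g, 'm) monoid_scheme \<Rightarrow> ('k::field, (nat \<Rightarrow> 'g) \<Rightarrow> 'k) ffg_data"
  where "map_ffg \<Gamma> = inv_fun_ffg \<Gamma> (\<lambda>I. extensional (I \<rightarrow>\<^sub>E carrier \<Gamma>))"


section \<open>Algebraic groups\<close>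

text \<open>Over an algebraically closed field of characteristic \<open>0\<close> every affine algebraic group is
  reduced (Cartier), so it is given by its group \<open>H(k)\<close> of points together with the algebra of
  regular functions on it. That the pair is an affine variety means that the algebra is finitely
  generated and that its homomorphisms to \<open>k\<close> are the evaluations at the points. The regular
  functions on a product are generated by those on the factors.\<close>

record ('h, 'k) alg_group = "'h monoid" +
  regfuns :: "('h \<Rightarrow> 'k) set"

locale affine_alg_group = group H for H :: "('h, 'k::field) alg_group" (structure) +
  assumes fin_gen: "\<exists>S. finite S \<and> S \<subseteq> extensional (carrier H) \<and> regfuns H = gen_funs (carrier H) S"
    and points: "\<phi> \<in> kalg_hom (fun_algebra (carrier H) (regfuns H)) base_algebra
      \<Longrightarrow> \<exists>!x. x \<in> carrier H \<and> (\<forall>f\<in>regfuns H. \<phi> f = f x)"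
    and mult_regular: "f \<in> regfuns H
      \<Longrightarrow> (\<lambda>p\<in>carrier H \<times> carrier H. f (fst p \<otimes> snd p)) \<in> gen_funs (carrier H \<times> carrier H)
            ((\<lambda>g. \<lambda>p\<in>carrier H \<times> carrier H. g (fst p)) ` regfuns H \<union>
             (\<lambda>g. \<lambda>p\<in>carrier H \<times> carrier H. g (snd p)) ` regfuns H)"
    and inv_regular: "f \<in> regfuns H \<Longrightarrow> (\<lambda>x\<in>carrier H. f (inv x)) \<in> regfuns H"

definition regfuns_pow :: "('h, 'k::field) alg_group \<Rightarrow> 'i set \<Rightarrow> (('i \<Rightarrow> 'h) \<Rightarrow> 'k) set"
  where "regfuns_pow H I = gen_funs (I \<rightarrow>\<^sub>E carrier H)
     (\<Union>i\<in>I. (\<lambda>f. \<lambda>x\<in>I \<rightarrow>\<^sub>E carrier H. f (x i)) ` regfuns H)"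

definition ad_ffg :: "('h, 'k::field) alg_group \<Rightarrow> ('k, (nat \<Rightarrow> 'h) \<Rightarrow> 'k) ffg_data"
  where "ad_ffg H = inv_fun_ffg H (regfuns_pow H)"

text \<open>The Zariski topology is generated by the principal open sets; its closed sets are the zero
  loci of sets of regular functions, see \<open>closedin_zariski\<close> below.\<close>

definition zariski :: "('h, 'k::field) alg_group \<Rightarrow> 'h topology"
  where "zariski H = topology_generated_by ((\<lambda>f. {x \<in> carrier H. f x \<noteq> 0}) ` regfuns H)"

definition alg_subgroup :: "('h, 'k) alg_group \<Rightarrow> 'h set \<Rightarrow> ('h, 'k) alg_group"
  where "alg_subgroup H K = H\<lparr>carrier := K, regfuns := (\<lambda>f. restrict f K) ` regfuns H\<rparr>"

text \<open>\<open>g\<close> is unipotent iff right translation by \<open>g\<close> on the coordinate ring is unipotent, i.e.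
  its difference from the identity is locally nilpotent.\<close>

definition unipotent :: "('h, 'k::field) alg_group \<Rightarrow> 'h \<Rightarrow> bool"
  where "unipotent H g \<longleftrightarrow> (\<forall>f\<in>regfuns H. \<exists>n.
     ((\<lambda>u. \<lambda>x\<in>carrier H. u (x \<otimes>\<^bsub>H\<^esub> g) - u x) ^^ n) f = (\<lambda>x\<in>carrier H. 0))"

text \<open>The unipotent radical is the largest connected closed normal unipotent subgroup, hence the
  union of all of them.\<close>

definition unipotent_radical :: "('h, 'k::field) alg_group \<Rightarrow> 'h set"
  where "unipotent_radical H = \<Union>{U. U \<lhd> H \<and> closedin (zariski H) U \<and>
     connectedin (zariski H) U \<and> (\<forall>u\<in>U. unipotent H u)}"

text \<open>Reductive groups are not required to be connected.\<close>

definition reductive :: "('h, 'k::field) alg_group \<Rightarrow> bool"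
  where "reductive H \<longleftrightarrow> affine_alg_group H \<and> unipotent_radical H = {\<one>\<^bsub>H\<^esub>}"


section \<open>Representations\<close>

definition semisimple_reps :: "('g, 'm) monoid_scheme \<Rightarrow> ('h, 'k::field) alg_group \<Rightarrow> ('g \<Rightarrow> 'h) set"
  where "semisimple_reps \<Gamma> H = {\<rho> \<in> hom \<Gamma> H \<inter> extensional (carrier \<Gamma>).
     reductive (alg_subgroup H (zariski H closure_of (\<rho> ` carrier \<Gamma>)))}"

definition globally_conjugate ::
    "('g, 'm) monoid_scheme \<Rightarrow> ('h, 'n) monoid_scheme \<Rightarrow> ('g \<Rightarrow> 'h) \<Rightarrow> ('g \<Rightarrow> 'h) \<Rightarrow> bool"
  where "globally_conjugate \<Gamma> H \<rho>\<^sub>1 \<rho>\<^sub>2 \<longleftrightarrow>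
     (\<exists>h\<in>carrier H. \<forall>\<gamma>\<in>carrier \<Gamma>. \<rho>\<^sub>1 \<gamma> = h \<otimes>\<^bsub>H\<^esub> \<rho>\<^sub>2 \<gamma> \<otimes>\<^bsub>H\<^esub> inv\<^bsub>H\<^esub> h)"

definition element_conjugate ::
    "('g, 'm) monoid_scheme \<Rightarrow> ('h, 'n) monoid_scheme \<Rightarrow> ('g \<Rightarrow> 'h) \<Rightarrow> ('g \<Rightarrow> 'h) \<Rightarrow> bool"
  where "element_conjugate \<Gamma> H \<rho>\<^sub>1 \<rho>\<^sub>2 \<longleftrightarrow>
     (\<forall>\<gamma>\<in>carrier \<Gamma>. \<exists>h\<in>carrier H. \<rho>\<^sub>1 \<gamma> = h \<otimes>\<^bsub>H\<^esub> \<rho>\<^sub>2 \<gamma> \<otimes>\<^bsub>H\<^esub> inv\<^bsub>H\<^esub> h)"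

definition semisimple_classes :: "('g, 'm) monoid_scheme \<Rightarrow> ('h, 'k::field) alg_group \<Rightarrow> ('g \<Rightarrow> 'h) set set"
  where "semisimple_classes \<Gamma> H = semisimple_reps \<Gamma> H //
     {(\<rho>\<^sub>1, \<rho>\<^sub>2). \<rho>\<^sub>1 \<in> semisimple_reps \<Gamma> H \<and> \<rho>\<^sub>2 \<in> semisimple_reps \<Gamma> H \<and> globally_conjugate \<Gamma> H \<rho>\<^sub>1 \<rho>\<^sub>2}"

text \<open>Since HOL cannot quantify over types inside a formula, the groups \<open>\<Gamma>\<close> range over all
  groups whose elements are taken from the type \<open>'g\<close>, an arbitrary parameter.\<close>

definition acceptable :: "'g itself \<Rightarrow> ('h, 'k::field) alg_group \<Rightarrow> bool"
  where "acceptable _ H \<longleftrightarrow> (\<forall>\<Gamma> :: 'g monoid. group \<Gamma> \<longrightarrow>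
     (\<forall>\<rho>\<^sub>1 \<in> semisimple_reps \<Gamma> H. \<forall>\<rho>\<^sub>2 \<in> semisimple_reps \<Gamma> H.
        element_conjugate \<Gamma> H \<rho>\<^sub>1 \<rho>\<^sub>2 \<longrightarrow> globally_conjugate \<Gamma> H \<rho>\<^sub>1 \<rho>\<^sub>2))"

definition Theta :: "('g, 'm) monoid_scheme \<Rightarrow> ('h, 'k::field) alg_group \<Rightarrow> ('g \<Rightarrow> 'h)
    \<Rightarrow> nat set \<Rightarrow> ((nat \<Rightarrow> 'h) \<Rightarrow> 'k) \<Rightarrow> (nat \<Rightarrow> 'g) \<Rightarrow> 'k"
  where "Theta \<Gamma> H \<rho> = (\<lambda>I\<in>ffg_obj. \<lambda>f\<in>carrier (ffg_val (ad_ffg H) I).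
     \<lambda>\<gamma>\<in>I \<rightarrow>\<^sub>E carrier \<Gamma>. f (\<lambda>i\<in>I. \<rho> (\<gamma> i)))"


section \<open>Basic facts\<close>

subsection \<open>Free groups\<close>

lemma reduced_Nil [simp]: "reduced []"
  by (simp add: reduced_def)

lemma reduced_Cons: "reduced (a # w) \<longleftrightarrow> reduced w \<and> (w = [] \<or> \<not> cancels a (hd w))"
  by (auto simp: reduced_def successively_Cons)

lemma reduced_push: "reduced w \<Longrightarrow> reduced (push a w)"
  by (cases w) (auto simp: reduced_Cons)

lemma reduced_foldr_push: "reduced w \<Longrightarrow> reduced (foldr push u w)"
  by (induction u) (auto intro: reduced_push)

lemma set_push: "fst ` set (push a w) \<subseteq> insert (fst a) (fst ` set w)"
  by (cases w) auto

lemma set_foldr_push: "fst ` set (foldr push u w) \<subseteq> fst ` set u \<union> fst ` set w"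
proof (induction u)
  case (Cons a u)
  then show ?case by (simp, intro order_trans[OF set_push]) auto
qed simp

lemma push_cancel: "\<lbrakk>reduced w; cancels a b\<rbrakk> \<Longrightarrow> push a (push b w) = w"
  by (cases a; cases b; cases w rule: list.exhaust; cases "tl w")
     (auto simp: cancels_def reduced_Cons)

lemma foldr_push_push: "reduced w \<Longrightarrow> foldr push (push a v) w = push a (foldr push v w)"
  by (cases v) (auto simp: push_cancel reduced_foldr_push)

lemma foldr_push_assoc:
  "reduced w \<Longrightarrow> foldr push (foldr push u v) w = foldr push u (foldr push v w)"
  by (induction u) (auto simp: foldr_push_push)

lemma foldr_push_Nil: "reduced w \<Longrightarrow> foldr push w [] = w"
proof (induction w)
  case (Cons a w)
  then show ?case by (cases w) (auto simp: reduced_Cons)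
qed simp

lemma foldr_push_inverse: "foldr push (rev (map (\<lambda>a. (fst a, \<not> snd a)) w)) w = []"
  by (induction w) (auto simp: cancels_def)

lemma group_free_group: "group (free_group I)"
proof (rule groupI)
  fix w assume "w \<in> carrier (free_group I)"
  then have w: "reduced w" "fst ` set w \<subseteq> I" by (auto simp: free_group_def)
  let ?v = "rev (map (\<lambda>a. (fst a, \<not> snd a)) w)"
  have "foldr push (foldr push ?v []) w = []"
    by (simp only: foldr_push_assoc[OF w(1)] foldr.simps id_apply foldr_push_inverse)
  moreover have "fst ` set (foldr push ?v []) \<subseteq> I"
    using set_foldr_push[of ?v "[]"] w(2) by force
  ultimately show "\<exists>y\<in>carrier (free_group I). y \<otimes>\<^bsub>free_group I\<^esub> w = \<one>\<^bsub>free_group I\<^esub>"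
    by (intro bexI[of _ "foldr push ?v []"]) (auto simp: free_group_def reduced_foldr_push)
next
  fix u v assume "u \<in> carrier (free_group I)" "v \<in> carrier (free_group I)"
  moreover from this have "fst ` set (foldr push u v) \<subseteq> I"
    by (intro order_trans[OF set_foldr_push]) (auto simp: free_group_def)
  ultimately show "u \<otimes>\<^bsub>free_group I\<^esub> v \<in> carrier (free_group I)"
    by (simp add: free_group_def reduced_foldr_push)
qed (auto simp: free_group_def foldr_push_assoc)

lemma free_gen_closed: "i \<in> I \<Longrightarrow> free_gen i \<in> carrier (free_group I)"
  by (simp add: free_group_def free_gen_def reduced_Cons)

context group begin

lemma word_eval_closed:
  "\<lbrakk>x \<in> I \<rightarrow> carrier G; fst ` set w \<subseteq> I\<rbrakk> \<Longrightarrow> word_eval G x w \<in> carrier G"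
  by (induction w) auto

lemma word_eval_push:
  assumes x: "x \<in> I \<rightarrow> carrier G" and "fst a \<in> I" "fst ` set w \<subseteq> I"
  shows "word_eval G x (push a w) = word_eval G x (a # w)"
proof (cases w)
  case (Cons b v)
  have "word_eval G x v \<in> carrier G" using assms Cons by (auto intro: word_eval_closed[OF x])
  moreover have "x (fst a) \<in> carrier G" using assms by auto
  ultimately show ?thesis
    using Cons by (auto simp: cancels_def m_assoc[symmetric])
qed simp

lemma word_eval_mult:
  assumes x: "x \<in> I \<rightarrow> carrier G" and "fst ` set u \<subseteq> I" "fst ` set v \<subseteq> I"
  shows "word_eval G x (foldr push u v) = word_eval G x u \<otimes> word_eval G x v"
  using assms(2)
proof (induction u)
  case Nil
  then show ?case using word_eval_closed[OF x assms(3)] by simp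
next
  case (Cons a u)
  have "fst ` set (foldr push u v) \<subseteq> I"
    using Cons.prems assms(3) by (intro order_trans[OF set_foldr_push]) auto
  moreover have "x (fst a) \<in> carrier G" using x Cons.prems by auto
  ultimately show ?case
    using Cons word_eval_closed[OF x assms(3)] word_eval_closed[OF x, of u]
    by (auto simp: word_eval_push[OF x] m_assoc)
qed

lemma word_eval_hom:
  "x \<in> I \<rightarrow> carrier G \<Longrightarrow> word_eval G x \<in> hom (free_group I) G"
  by (auto simp: hom_def free_group_def word_eval_mult intro: word_eval_closed)

lemma word_eval_gen: "\<lbrakk>x \<in> I \<rightarrow> carrier G; i \<in> I\<rbrakk> \<Longrightarrow> word_eval G x (free_gen i) = x i"
  by (auto simp: free_gen_def Pi_iff)

lemma word_eval_unique:
  assumes h: "h \<in> hom (free_group I) G" and w: "w \<in> carrier (free_group I)"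
  shows "h w = word_eval G (\<lambda>i\<in>I. h (free_gen i)) w"
proof -
  interpret F: group "free_group I" by (rule group_free_group)
  interpret h: group_hom "free_group I" G h
    using h by (simp add: group_hom_def group_hom_axioms_def F.group_axioms group_axioms)
  have letter: "h [a] = (if snd a then h (free_gen (fst a)) else inv h (free_gen (fst a)))"
    if "fst a \<in> I" for a
  proof (cases "snd a")
    case True
    then show ?thesis by (cases a) (auto simp: free_gen_def)
  next
    case False
    have c: "[a] \<in> carrier (free_group I)" using that by (auto simp: free_group_def reduced_Cons)
    have "[a] \<otimes>\<^bsub>free_group I\<^esub> free_gen (fst a) = \<one>\<^bsub>free_group I\<^esub>"
      using False by (simp add: free_group_def free_gen_def cancels_def)
    then have "[a] = inv\<^bsub>free_group I\<^esub> free_gen (fst a)"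
      using F.inv_equality[OF _ free_gen_closed[OF that] c] by simp
    then show ?thesis using False free_gen_closed[OF that] by simp
  qed
  show ?thesis using w
  proof (induction w)
    case Nil
    then show ?case using h.hom_one by (simp add: free_group_def)
  next
    case (Cons a w)
    have c: "fst a \<in> I" "w \<in> carrier (free_group I)" "[a] \<in> carrier (free_group I)"
      using Cons.prems by (auto simp: free_group_def reduced_Cons)
    have "[a] \<otimes>\<^bsub>free_group I\<^esub> w = a # w"
      using Cons.prems by (cases w) (auto simp: free_group_def reduced_Cons)
    then have "h (a # w) = h [a] \<otimes> h w" using c by (metis h.hom_mult)
    then show ?case using Cons.IH[OF c(2)] c(1) by (simp add: letter)
  qed
qed

lemma tuple_map_closed:
  assumes \<phi>: "\<phi> \<in> hom (free_group I) (free_group J)" and x: "x \<in> J \<rightarrow>\<^sub>E carrier G"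
  shows "tuple_map G I \<phi> x \<in> I \<rightarrow>\<^sub>E carrier G"
proof -
  have "word_eval G x \<in> hom (free_group J) G" using x by (intro word_eval_hom) auto
  then have "word_eval G x (\<phi> (free_gen i)) \<in> carrier G" if "i \<in> I" for i
    using hom_in_carrier[OF _ hom_in_carrier[OF \<phi> free_gen_closed[OF that]]] by blast
  then show ?thesis by (auto simp: tuple_map_def)
qed

text \<open>\<open>tuple_map\<close> is composition with \<open>\<phi>\<close>.\<close>

lemma word_eval_tuple_map:
  assumes \<phi>: "\<phi> \<in> hom (free_group I) (free_group J)" and x: "x \<in> J \<rightarrow>\<^sub>E carrier G"
    and w: "w \<in> carrier (free_group I)"
  shows "word_eval G (tuple_map G I \<phi> x) w = word_eval G x (\<phi> w)"
proof -
  have "word_eval G x \<in> hom (free_group J) G" using x by (intro word_eval_hom) auto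
  then have "word_eval G x \<circ> \<phi> \<in> hom (free_group I) G" using \<phi> Group.hom_compose by blast
  from word_eval_unique[OF this w] show ?thesis by (simp add: tuple_map_def o_def)
qed

lemma tuple_map_id:
  assumes x: "x \<in> I \<rightarrow>\<^sub>E carrier G"
  shows "tuple_map G I (\<lambda>w\<in>carrier (free_group I). w) x = x"
proof (rule ext)
  fix i
  show "tuple_map G I (\<lambda>w\<in>carrier (free_group I). w) x i = x i"
    using word_eval_gen[of x I i] x PiE_arb[OF x, of i]
    by (cases "i \<in> I") (auto simp: tuple_map_def free_gen_closed)
qed

lemma tuple_map_comp:
  assumes "\<phi> \<in> hom (free_group I) (free_group J)" "\<psi> \<in> hom (free_group J) (free_group K)"
    and "x \<in> K \<rightarrow>\<^sub>E carrier G"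
  shows "tuple_map G I (compose (carrier (free_group I)) \<psi> \<phi>) x
    = tuple_map G I \<phi> (tuple_map G J \<psi> x)"
proof -
  have "word_eval G (tuple_map G J \<psi> x) (\<phi> (free_gen i)) = word_eval G x (\<psi> (\<phi> (free_gen i)))"
    if "i \<in> I" for i
    using assms that by (intro word_eval_tuple_map) (auto intro: hom_in_carrier free_gen_closed)
  then show ?thesis
    by (auto simp: tuple_map_def compose_def free_gen_closed)
qed

end

lemma word_eval_hom_image:
  assumes "group G" "group H" "\<rho> \<in> hom G H" "x \<in> I \<rightarrow> carrier G" "fst ` set w \<subseteq> I"
  shows "\<rho> (word_eval G x w) = word_eval H (\<lambda>i\<in>I. \<rho> (x i)) w"
proof -
  interpret h: group_hom G H \<rho>
    using assms by (simp add: group_hom_def group_hom_axioms_def)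
  show ?thesis using assms(5)
  proof (induction w)
    case (Cons a w)
    then have "x (fst a) \<in> carrier G" "word_eval G x w \<in> carrier G"
      using assms(4) h.G.word_eval_closed[OF assms(4)] by auto
    then have "\<rho> (word_eval G x (a # w))
        = (if snd a then \<rho> (x (fst a)) else inv\<^bsub>H\<^esub> \<rho> (x (fst a))) \<otimes>\<^bsub>H\<^esub> \<rho> (word_eval G x w)"
      by (cases "snd a") simp_all
    then show ?case using Cons by simp
  qed simp
qed

subsection \<open>Algebras of functions\<close>

definition fun_closed :: "'x set \<Rightarrow> ('x \<Rightarrow> 'k::field) set \<Rightarrow> bool"
  where "fun_closed D B \<longleftrightarrow> B \<subseteq> extensional D \<and> (\<lambda>x\<in>D. 1) \<in> B \<and>
    (\<forall>f\<in>B. \<forall>g\<in>B. (\<lambda>x\<in>D. f x + g x) \<in> B \<and> (\<lambda>x\<in>D. f x * g x) \<in> B) \<and>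
    (\<forall>c. \<forall>f\<in>B. (\<lambda>x\<in>D. c * f x) \<in> B)"

lemma cring_base: "cring (base_algebra :: ('k::field, 'k) module)"
proof (rule cringI)
  show "abelian_group (base_algebra :: ('k, 'k) module)"
    by (rule abelian_groupI)
      (auto simp: base_algebra_def algebra_simps intro: exI[of _ "- x" for x] left_minus)
  show "Group.comm_monoid (base_algebra :: ('k, 'k) module)"
    by (rule comm_monoidI) (auto simp: base_algebra_def)
qed (auto simp: base_algebra_def algebra_simps)

lemma fun_closed_zero: "fun_closed D B \<Longrightarrow> (\<lambda>x\<in>D. 0) \<in> B"
proof -
  assume "fun_closed D B"
  then have "(\<lambda>x\<in>D. 0 * (\<lambda>x\<in>D. 1) x) \<in> B" unfolding fun_closed_def by blast
  then show ?thesis by simp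
qed

lemma ext_restrict_eq: "f \<in> extensional D \<Longrightarrow> (\<And>x. x \<in> D \<Longrightarrow> g x = f x) \<Longrightarrow> (\<lambda>x\<in>D. g x) = f"
  by (rule extensionalityI[of _ D]) auto

lemma algebra_fun_algebra:
  assumes B: "fun_closed D B"
  shows "algebra base_algebra (fun_algebra D B)"
proof (rule algebraI[OF cring_base])
  have ext: "f \<in> extensional D" if "f \<in> B" for f using B that by (auto simp: fun_closed_def)
  have add: "(\<lambda>x\<in>D. f x + g x) \<in> B" and mul: "(\<lambda>x\<in>D. f x * g x) \<in> B" if "f \<in> B" "g \<in> B" for f g
    using B that by (auto simp: fun_closed_def)
  have scale: "(\<lambda>x\<in>D. c * f x) \<in> B" if "f \<in> B" for f c
    using B that by (auto simp: fun_closed_def)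
  have one: "(\<lambda>x\<in>D. 1) \<in> B" using B by (auto simp: fun_closed_def)
  show "cring (fun_algebra D B)"
  proof (rule cringI)
    show "abelian_group (fun_algebra D B)"
    proof (rule abelian_groupI)
      fix f assume "f \<in> carrier (fun_algebra D B)"
      then have "(\<lambda>x\<in>D. -1 * f x) \<in> B" using scale[of f "-1"] by (simp add: fun_algebra_def)
      then show "\<exists>y\<in>carrier (fun_algebra D B). y \<oplus>\<^bsub>fun_algebra D B\<^esub> f = \<zero>\<^bsub>fun_algebra D B\<^esub>"
        by (intro bexI[of _ "\<lambda>x\<in>D. -1 * f x"]) (auto simp: fun_algebra_def)
    qed (auto simp: fun_algebra_def add fun_closed_zero[OF B] algebra_simps
        intro!: ext_restrict_eq ext restrict_ext)
    show "Group.comm_monoid (fun_algebra D B)"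
      by (rule comm_monoidI) (auto simp: fun_algebra_def mul one algebra_simps
        intro!: ext_restrict_eq ext restrict_ext)
  qed (auto simp: fun_algebra_def algebra_simps intro!: restrict_ext)
qed (use B in \<open>auto simp: fun_algebra_def base_algebra_def fun_closed_def algebra_simps
      intro!: restrict_ext ext_restrict_eq\<close>)

lemma fun_closed_extensional: "fun_closed D (extensional D)"
  by (auto simp: fun_closed_def)

lemma ksubalgebra_fun_algebra:
  assumes C: "fun_closed D C"
  shows "ksubalgebra B (fun_algebra D C) \<longleftrightarrow> B \<subseteq> C \<and> fun_closed D B"
proof
  assume "ksubalgebra B (fun_algebra D C)"
  then have s: "subring B (fun_algebra D C)" and k: "\<forall>c. \<forall>f\<in>B. (\<lambda>x\<in>D. c * f x) \<in> B"
    by (auto simp: ksubalgebra_def fun_algebra_def)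
  interpret subring B "fun_algebra D C" by (rule s)
  have "B \<subseteq> C" using subset by (simp add: fun_algebra_def)
  moreover have "C \<subseteq> extensional D" using C by (simp add: fun_closed_def)
  moreover have "(\<lambda>x\<in>D. 1) \<in> B" using submonoid.one_closed[OF submonoid_axioms]
    by (simp add: fun_algebra_def)
  moreover have "(\<lambda>x\<in>D. f x + g x) \<in> B" "(\<lambda>x\<in>D. f x * g x) \<in> B" if "f \<in> B" "g \<in> B" for f g
    using subgroup.m_closed[OF subgroup_axioms that] submonoid.m_closed[OF submonoid_axioms that]
    by (auto simp: fun_algebra_def)
  ultimately show "B \<subseteq> C \<and> fun_closed D B" using k by (auto simp: fun_closed_def)
next
  assume B: "B \<subseteq> C \<and> fun_closed D B"
  interpret A: algebra base_algebra "fun_algebra D C" by (rule algebra_fun_algebra[OF C])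
  have "subring B (fun_algebra D C)"
  proof (rule ring.subringI)
    show "ring (fun_algebra D C)" by unfold_locales
    fix f assume f: "f \<in> B"
    then have m: "(\<lambda>x\<in>D. -1 * f x) \<in> B" using B unfolding fun_closed_def by blast
    have "\<ominus>\<^bsub>fun_algebra D C\<^esub> f = (\<lambda>x\<in>D. -1 * f x)"
      by (rule A.minus_equality) (use f m B in \<open>auto simp: fun_algebra_def\<close>)
    then show "\<ominus>\<^bsub>fun_algebra D C\<^esub> f \<in> B" using m by simp
  qed (use B in \<open>auto simp: fun_algebra_def fun_closed_def\<close>)
  then show "ksubalgebra B (fun_algebra D C)"
    using B by (auto simp: ksubalgebra_def fun_algebra_def fun_closed_def)
qed

lemma gen_funs_eq: "gen_funs D S = \<Inter>{B. fun_closed D B \<and> S \<subseteq> B}"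
  unfolding gen_funs_def ksubalgebra_fun_algebra[OF fun_closed_extensional]
  by (rule arg_cong[of _ _ Inter]) (auto simp: fun_closed_def)

lemma gen_funs_minimal: "\<lbrakk>fun_closed D B; S \<subseteq> B\<rbrakk> \<Longrightarrow> gen_funs D S \<subseteq> B"
  by (auto simp: gen_funs_eq)

lemma gen_funs_superset: "S \<subseteq> gen_funs D S"
  by (auto simp: gen_funs_eq)

lemma fun_closed_gen_funs:
  assumes "S \<subseteq> extensional D"
  shows "fun_closed D (gen_funs D S)"
proof -
  have "gen_funs D S \<subseteq> extensional D"
    by (rule gen_funs_minimal[OF fun_closed_extensional assms])
  then show ?thesis
    unfolding fun_closed_def by (auto simp: gen_funs_eq fun_closed_def)
qed

lemma fun_closed_pullback:
  fixes C :: "('x \<Rightarrow> 'k::field) set" and D :: "'y set"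
  assumes C: "fun_closed E C" and t: "t \<in> E \<rightarrow> D"
  shows "fun_closed D {q \<in> extensional D. (\<lambda>x\<in>E. q (t x)) \<in> C}"
proof -
  have comp: "(\<lambda>x\<in>E. (\<lambda>y\<in>D. r y) (t x)) = (\<lambda>x\<in>E. r (t x))" for r :: "'y \<Rightarrow> 'k"
    using t by (intro restrict_ext) auto
  have "(\<lambda>x\<in>E. 1) \<in> C"
    and add: "\<And>f g. \<lbrakk>f \<in> C; g \<in> C\<rbrakk> \<Longrightarrow> (\<lambda>x\<in>E. f x + g x) \<in> C"
    and mul: "\<And>f g. \<lbrakk>f \<in> C; g \<in> C\<rbrakk> \<Longrightarrow> (\<lambda>x\<in>E. f x * g x) \<in> C"
    and scale: "\<And>f c. f \<in> C \<Longrightarrow> (\<lambda>x\<in>E. c * f x) \<in> C"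
    using C unfolding fun_closed_def by blast+
  moreover have "(\<lambda>x\<in>E. q (t x) + r (t x)) \<in> C" "(\<lambda>x\<in>E. q (t x) * r (t x)) \<in> C"
    if "(\<lambda>x\<in>E. q (t x)) \<in> C" "(\<lambda>x\<in>E. r (t x)) \<in> C" for q r
    using add[OF that] mul[OF that] by (auto cong: restrict_cong)
  moreover have "(\<lambda>x\<in>E. c * q (t x)) \<in> C" if "(\<lambda>x\<in>E. q (t x)) \<in> C" for q c
    using scale[OF that] by (auto cong: restrict_cong)
  ultimately show ?thesis unfolding fun_closed_def by (simp add: comp del: restrict_apply)
qed

subsection \<open>The FFG-algebras in question\<close>

lemma conj_tuple_closed:
  assumes "group G" "g \<in> carrier G" "x \<in> I \<rightarrow>\<^sub>E carrier G"
  shows "(\<lambda>i\<in>I. g \<otimes>\<^bsub>G\<^esub> x i \<otimes>\<^bsub>G\<^esub> inv\<^bsub>G\<^esub> g) \<in> I \<rightarrow>\<^sub>E carrier G"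
proof -
  interpret group G by fact
  show ?thesis using assms by auto
qed

lemma fun_closed_conj_invariant:
  assumes "group G" "fun_closed (I \<rightarrow>\<^sub>E carrier G) B"
  shows "fun_closed (I \<rightarrow>\<^sub>E carrier G) {f \<in> B. conj_invariant G I f}"
proof -
  interpret group G by fact
  show ?thesis
    using assms(2) unfolding fun_closed_def conj_invariant_def by (auto simp: PiE_iff)
qed

lemma tuple_map_conj:
  assumes "group G" and \<phi>: "\<phi> \<in> hom (free_group I) (free_group J)"
    and g: "g \<in> carrier G" and x: "x \<in> J \<rightarrow>\<^sub>E carrier G"
  shows "tuple_map G I \<phi> (\<lambda>j\<in>J. g \<otimes>\<^bsub>G\<^esub> x j \<otimes>\<^bsub>G\<^esub> inv\<^bsub>G\<^esub> g)
    = (\<lambda>i\<in>I. g \<otimes>\<^bsub>G\<^esub> tuple_map G I \<phi> x i \<otimes>\<^bsub>G\<^esub> inv\<^bsub>G\<^esub> g)"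
proof -
  interpret group G by fact
  have c: "(\<lambda>y. g \<otimes>\<^bsub>G\<^esub> y \<otimes>\<^bsub>G\<^esub> inv\<^bsub>G\<^esub> g) \<in> hom G G"
    using g by (auto simp: hom_def m_assoc inv_solve_left)
  have "g \<otimes>\<^bsub>G\<^esub> word_eval G x w \<otimes>\<^bsub>G\<^esub> inv\<^bsub>G\<^esub> g
      = word_eval G (\<lambda>j\<in>J. g \<otimes>\<^bsub>G\<^esub> x j \<otimes>\<^bsub>G\<^esub> inv\<^bsub>G\<^esub> g) w" if "fst ` set w \<subseteq> J" for w
    using word_eval_hom_image[OF assms(1,1) c _ that, of x] x by auto
  moreover have "fst ` set (\<phi> (free_gen i)) \<subseteq> J" if "i \<in> I" for i
    using hom_in_carrier[OF \<phi> free_gen_closed[OF that]] by (simp add: free_group_def)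
  ultimately show ?thesis
    by (auto simp: tuple_map_def restrict_def)
qed

lemma ffg_algebra_inv_fun_ffg:
  fixes F :: "nat set \<Rightarrow> ((nat \<Rightarrow> 'g) \<Rightarrow> 'k::field) set"
  assumes G: "group G"
    and F: "\<And>I. fun_closed (I \<rightarrow>\<^sub>E carrier G) (F I)"
    and pull: "\<And>I J \<phi> f. \<lbrakk>I \<in> ffg_obj; J \<in> ffg_obj; \<phi> \<in> ffg_arr I J; f \<in> F I\<rbrakk>
      \<Longrightarrow> (\<lambda>x\<in>J \<rightarrow>\<^sub>E carrier G. f (tuple_map G I \<phi> x)) \<in> F J"
  shows "ffg_algebra (inv_fun_ffg G F)"
proof (rule ffg_algebra.intro)
  interpret group G by fact
  note closed = fun_closed_conj_invariant[OF G F]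
  fix I assume I: "I \<in> ffg_obj"
  show "algebra (base_algebra :: ('k, 'k) module) (ffg_val (inv_fun_ffg G F) I)"
    unfolding inv_fun_ffg_def by (simp add: algebra_fun_algebra[OF closed])
  have ext: "f \<in> F I \<Longrightarrow> f \<in> extensional (I \<rightarrow>\<^sub>E carrier G)" for f I
    using F[of I] by (auto simp: fun_closed_def)
  show "ffg_map (inv_fun_ffg G F) I I (\<lambda>w\<in>carrier (free_group I). w) a = a"
    if "a \<in> carrier (ffg_val (inv_fun_ffg G F) I)" for a
    using that by (auto simp: inv_fun_ffg_def fun_algebra_def tuple_map_id intro!: ext_restrict_eq ext)
  fix J \<phi> assume J: "J \<in> ffg_obj" and \<phi>: "\<phi> \<in> ffg_arr I J"
  then have \<phi>h: "\<phi> \<in> hom (free_group I) (free_group J)" by (simp add: ffg_arr_def)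
  have inv: "conj_invariant G J (\<lambda>x\<in>J \<rightarrow>\<^sub>E carrier G. f (tuple_map G I \<phi> x))"
    if "conj_invariant G I f" for f :: "(nat \<Rightarrow> 'g) \<Rightarrow> 'k"
    unfolding conj_invariant_def
  proof (intro ballI)
    fix g x assume g: "g \<in> carrier G" and x: "x \<in> J \<rightarrow>\<^sub>E carrier G"
    show "(\<lambda>x\<in>J \<rightarrow>\<^sub>E carrier G. f (tuple_map G I \<phi> x)) (\<lambda>j\<in>J. g \<otimes>\<^bsub>G\<^esub> x j \<otimes>\<^bsub>G\<^esub> inv\<^bsub>G\<^esub> g)
        = (\<lambda>x\<in>J \<rightarrow>\<^sub>E carrier G. f (tuple_map G I \<phi> x)) x"
      using that g x tuple_map_closed[OF \<phi>h x] conj_tuple_closed[OF G g x]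
      by (simp add: conj_invariant_def tuple_map_conj[OF G \<phi>h g x])
  qed
  note in_J = pull[OF I J \<phi>] inv
  show "ffg_map (inv_fun_ffg G F) I J \<phi>
      \<in> kalg_hom (ffg_val (inv_fun_ffg G F) I) (ffg_val (inv_fun_ffg G F) J)"
    using closed[of I] in_J tuple_map_closed[OF \<phi>h]
    by (auto simp: kalg_hom_def ring_hom_def inv_fun_ffg_def fun_algebra_def fun_closed_def
        intro!: restrict_ext)
  fix K \<psi> and a :: "(nat \<Rightarrow> 'g) \<Rightarrow> 'k"
  assume K: "K \<in> ffg_obj" and \<psi>: "\<psi> \<in> ffg_arr J K"
    and a: "a \<in> carrier (ffg_val (inv_fun_ffg G F) I)"
  have \<psi>h: "\<psi> \<in> hom (free_group J) (free_group K)" using \<psi> by (simp add: ffg_arr_def)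
  show "ffg_map (inv_fun_ffg G F) I K (compose (carrier (free_group I)) \<psi> \<phi>) a
      = ffg_map (inv_fun_ffg G F) J K \<psi> (ffg_map (inv_fun_ffg G F) I J \<phi> a)"
    using a in_J tuple_map_closed[OF \<psi>h]
    by (auto simp: inv_fun_ffg_def fun_algebra_def tuple_map_comp[OF \<phi>h \<psi>h] intro!: restrict_ext)
qed

lemma ffg_algebra_map_ffg: "group \<Gamma> \<Longrightarrow> ffg_algebra (map_ffg \<Gamma> :: ('k::field, _) ffg_data)"
  unfolding map_ffg_def by (rule ffg_algebra_inv_fun_ffg) (auto simp: fun_closed_extensional)

context affine_alg_group begin

lemma fun_closed_regfuns: "fun_closed (carrier H) (regfuns H)"
  using fin_gen fun_closed_gen_funs by metis

lemma fun_closed_regfuns_pow: "fun_closed (I \<rightarrow>\<^sub>E carrier H) (regfuns_pow H I)"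
  unfolding regfuns_pow_def by (rule fun_closed_gen_funs) auto

lemma regfuns_pow_coord:
  "\<lbrakk>f \<in> regfuns H; i \<in> I\<rbrakk> \<Longrightarrow> (\<lambda>x\<in>I \<rightarrow>\<^sub>E carrier H. f (x i)) \<in> regfuns_pow H I"
  unfolding regfuns_pow_def by (rule subsetD[OF gen_funs_superset]) auto

lemma regfuns_pow_word_eval:
  fixes w :: "'i word"
  assumes "f \<in> regfuns H" "fst ` set w \<subseteq> I"
  shows "(\<lambda>x\<in>I \<rightarrow>\<^sub>E carrier H. f (word_eval H x w)) \<in> regfuns_pow H I"
  using assms
proof (induction w arbitrary: f)
  case Nil
  let ?D = "I \<rightarrow>\<^sub>E carrier H"
  have "(\<lambda>x\<in>?D. f \<one> * (\<lambda>x\<in>?D. 1) x) \<in> regfuns_pow H I"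
    using fun_closed_regfuns_pow[of I] unfolding fun_closed_def by blast
  moreover have "(\<lambda>x\<in>?D. f \<one> * (\<lambda>x\<in>?D. 1) x) = (\<lambda>x\<in>?D. f (word_eval H x []))"
    by (intro restrict_ext) auto
  ultimately show ?case by (simp only:)
next
  case (Cons a w)
  let ?D = "I \<rightarrow>\<^sub>E carrier H" and ?P = "carrier H \<times> carrier H"
  define l where "l x = (if snd a then x (fst a) else inv x (fst a))" for x :: "'i \<Rightarrow> 'h"
  have l: "l x \<in> carrier H" "word_eval H x w \<in> carrier H" if "x \<in> ?D" for x
    using that Cons.prems word_eval_closed[of x I w] by (auto simp: l_def)
  have letter: "(\<lambda>x\<in>?D. g (l x)) \<in> regfuns_pow H I" if g: "g \<in> regfuns H" for g
  proof (cases "snd a")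
    case True
    then show ?thesis using Cons.prems g by (auto simp: l_def regfuns_pow_coord)
  next
    case False
    have "(\<lambda>x\<in>?D. (\<lambda>y\<in>carrier H. g (inv y)) (x (fst a))) \<in> regfuns_pow H I"
      using Cons.prems by (intro regfuns_pow_coord inv_regular g) auto
    moreover have "(\<lambda>x\<in>?D. (\<lambda>y\<in>carrier H. g (inv y)) (x (fst a))) = (\<lambda>x\<in>?D. g (l x))"
      using Cons.prems False by (intro restrict_ext) (auto simp: l_def)
    ultimately show ?thesis by simp
  qed
  let ?B = "{q \<in> extensional ?P. (\<lambda>x\<in>?D. q (l x, word_eval H x w)) \<in> regfuns_pow H I}"
  have *: "(\<lambda>x\<in>?D. (\<lambda>p\<in>?P. r p) (l x, word_eval H x w)) = (\<lambda>x\<in>?D. r (l x, word_eval H x w))"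
    for r :: "'h \<times> 'h \<Rightarrow> 'k"
    using l by (intro restrict_ext) auto
  have "fun_closed ?P ?B"
    using fun_closed_pullback[OF fun_closed_regfuns_pow, of "\<lambda>x. (l x, word_eval H x w)" I ?P] l
    by auto
  moreover have "((\<lambda>g. \<lambda>p\<in>?P. g (fst p)) ` regfuns H \<union> (\<lambda>g. \<lambda>p\<in>?P. g (snd p)) ` regfuns H) \<subseteq> ?B"
    using Cons.IH Cons.prems letter by (auto simp: * simp del: restrict_apply)
  ultimately have "(\<lambda>p\<in>?P. f (fst p \<otimes> snd p)) \<in> ?B"
    using gen_funs_minimal mult_regular[OF Cons.prems(1)] by blast
  then have "(\<lambda>x\<in>?D. f (l x \<otimes> word_eval H x w)) \<in> regfuns_pow H I"
    by (simp add: * del: restrict_apply)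
  then show ?case by (simp only: l_def word_eval.simps)
qed

lemma ffg_algebra_ad_ffg: "ffg_algebra (ad_ffg H)"
  unfolding ad_ffg_def
proof (rule ffg_algebra_inv_fun_ffg[OF group_axioms fun_closed_regfuns_pow])
  fix I J \<phi> f assume "I \<in> ffg_obj" "J \<in> ffg_obj" and \<phi>: "\<phi> \<in> ffg_arr I J" and f: "f \<in> regfuns_pow H I"
  let ?I = "I \<rightarrow>\<^sub>E carrier H" and ?J = "J \<rightarrow>\<^sub>E carrier H"
  have \<phi>h: "\<phi> \<in> hom (free_group I) (free_group J)" using \<phi> by (simp add: ffg_arr_def)
  let ?B = "{q \<in> extensional ?I. (\<lambda>x\<in>?J. q (tuple_map H I \<phi> x)) \<in> regfuns_pow H J}"
  have *: "(\<lambda>x\<in>?J. (\<lambda>y\<in>?I. r y) (tuple_map H I \<phi> x)) = (\<lambda>x\<in>?J. r (tuple_map H I \<phi> x))" for r :: "_ \<Rightarrow> 'k"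
    using tuple_map_closed[OF \<phi>h] by (intro restrict_ext) auto
  have "fun_closed ?I ?B"
    using tuple_map_closed[OF \<phi>h] by (intro fun_closed_pullback[OF fun_closed_regfuns_pow]) auto
  moreover have "(\<Union>i\<in>I. (\<lambda>f. \<lambda>x\<in>?I. f (x i)) ` regfuns H) \<subseteq> ?B"
  proof -
    have "(\<lambda>x\<in>?J. f (tuple_map H I \<phi> x i)) \<in> regfuns_pow H J" if "i \<in> I" "f \<in> regfuns H" for i f
      using regfuns_pow_word_eval[OF that(2), of "\<phi> (free_gen i)" J]
        hom_in_carrier[OF \<phi>h free_gen_closed[OF that(1)]] that(1)
      by (simp add: tuple_map_def free_group_def)
    then show ?thesis by (auto simp: * simp del: restrict_apply)
  qed
  ultimately have "regfuns_pow H I \<subseteq> ?B" unfolding regfuns_pow_def[of H I] by (rule gen_funs_minimal)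
  with f show "(\<lambda>x\<in>?J. f (tuple_map H I \<phi> x)) \<in> regfuns_pow H J" by blast
qed

lemma Theta_ffg_hom:
  assumes "group \<Gamma>" and \<rho>: "\<rho> \<in> hom \<Gamma> H"
  shows "Theta \<Gamma> H \<rho> \<in> ffg_hom (ad_ffg H) (map_ffg \<Gamma>)"
proof -
  interpret \<Gamma>: group \<Gamma> by fact
  interpret r: group_hom \<Gamma> H \<rho>
    using \<rho> by (simp add: group_hom_def group_hom_axioms_def group_axioms \<Gamma>.group_axioms)
  have c: "(\<lambda>i\<in>I. \<rho> (\<gamma> i)) \<in> I \<rightarrow>\<^sub>E carrier H" if "\<gamma> \<in> I \<rightarrow>\<^sub>E carrier \<Gamma>" for \<gamma> and I :: "nat set"
    using that by (auto simp: PiE_iff)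
  have inv: "conj_invariant \<Gamma> I (\<lambda>\<gamma>\<in>I \<rightarrow>\<^sub>E carrier \<Gamma>. f (\<lambda>i\<in>I. \<rho> (\<gamma> i)))"
    if "conj_invariant H I f" for f :: "(nat \<Rightarrow> 'h) \<Rightarrow> 'k" and I
    unfolding conj_invariant_def
  proof (intro ballI)
    fix g x assume g: "g \<in> carrier \<Gamma>" and x: "x \<in> I \<rightarrow>\<^sub>E carrier \<Gamma>"
    have "(\<lambda>i\<in>I. \<rho> ((\<lambda>i\<in>I. g \<otimes>\<^bsub>\<Gamma>\<^esub> x i \<otimes>\<^bsub>\<Gamma>\<^esub> inv\<^bsub>\<Gamma>\<^esub> g) i))
        = (\<lambda>i\<in>I. \<rho> g \<otimes> (\<lambda>i\<in>I. \<rho> (x i)) i \<otimes> inv \<rho> g)"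
      using g x by (intro restrict_ext) (auto simp: PiE_iff)
    moreover have "\<rho> g \<in> carrier H" using g by simp
    then have "f (\<lambda>i\<in>I. \<rho> g \<otimes> (\<lambda>i\<in>I. \<rho> (x i)) i \<otimes> inv \<rho> g) = f (\<lambda>i\<in>I. \<rho> (x i))"
      using that c[OF x] unfolding conj_invariant_def by blast
    ultimately have "f (\<lambda>i\<in>I. \<rho> ((\<lambda>i\<in>I. g \<otimes>\<^bsub>\<Gamma>\<^esub> x i \<otimes>\<^bsub>\<Gamma>\<^esub> inv\<^bsub>\<Gamma>\<^esub> g) i)) = f (\<lambda>i\<in>I. \<rho> (x i))"
      by (simp only:)
    then show "(\<lambda>\<gamma>\<in>I \<rightarrow>\<^sub>E carrier \<Gamma>. f (\<lambda>i\<in>I. \<rho> (\<gamma> i))) (\<lambda>i\<in>I. g \<otimes>\<^bsub>\<Gamma>\<^esub> x i \<otimes>\<^bsub>\<Gamma>\<^esub> inv\<^bsub>\<Gamma>\<^esub> g)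
        = (\<lambda>\<gamma>\<in>I \<rightarrow>\<^sub>E carrier \<Gamma>. f (\<lambda>i\<in>I. \<rho> (\<gamma> i))) x"
      using x conj_tuple_closed[OF assms(1) g x] by simp
  qed
  have closed: "fun_closed (I \<rightarrow>\<^sub>E carrier H) {f \<in> regfuns_pow H I. conj_invariant H I f}" for I :: "nat set"
    by (rule fun_closed_conj_invariant[OF group_axioms fun_closed_regfuns_pow])
  have nat: "(\<lambda>i\<in>I. \<rho> (tuple_map \<Gamma> I \<phi> \<gamma> i)) = tuple_map H I \<phi> (\<lambda>j\<in>J. \<rho> (\<gamma> j))"
    if "\<phi> \<in> ffg_arr I J" "\<gamma> \<in> J \<rightarrow>\<^sub>E carrier \<Gamma>" for I J \<phi> \<gamma>
  proof -
    have "\<rho> (word_eval \<Gamma> \<gamma> (\<phi> (free_gen i))) = word_eval H (\<lambda>j\<in>J. \<rho> (\<gamma> j)) (\<phi> (free_gen i))"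
      if "i \<in> I" for i
    proof (rule word_eval_hom_image[OF assms(1) group_axioms \<rho>])
      have "\<phi> (free_gen i) \<in> carrier (free_group J)"
        using \<open>\<phi> \<in> ffg_arr I J\<close> that by (auto simp: ffg_arr_def intro: hom_in_carrier free_gen_closed)
      then show "fst ` set (\<phi> (free_gen i)) \<subseteq> J" by (simp add: free_group_def)
    qed (use \<open>\<gamma> \<in> J \<rightarrow>\<^sub>E carrier \<Gamma>\<close> in auto)
    then show ?thesis by (auto simp: tuple_map_def)
  qed
  interpret A: ffg_algebra "ad_ffg H" by (rule ffg_algebra_ad_ffg)
  have th: "Theta \<Gamma> H \<rho> I f = (\<lambda>\<gamma>\<in>I \<rightarrow>\<^sub>E carrier \<Gamma>. f (\<lambda>i\<in>I. \<rho> (\<gamma> i)))"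
    if "I \<in> ffg_obj" "f \<in> carrier (ffg_val (ad_ffg H) I)" for I f
    using that by (simp add: Theta_def)
  have val: "carrier (ffg_val (ad_ffg H) I) = {f \<in> regfuns_pow H I. conj_invariant H I f}" for I
    by (simp add: ad_ffg_def inv_fun_ffg_def fun_algebra_def)
  have "Theta \<Gamma> H \<rho> I \<in> kalg_hom (ffg_val (ad_ffg H) I) (ffg_val (map_ffg \<Gamma>) I)"
    if I: "I \<in> ffg_obj" for I
    using closed[of I] c[of _ I] inv[of I] I
    unfolding kalg_hom_def ring_hom_def Theta_def
    by (auto simp: ad_ffg_def map_ffg_def inv_fun_ffg_def fun_algebra_def fun_closed_def
        intro!: restrict_ext)
  moreover have "Theta \<Gamma> H \<rho> J (ffg_map (ad_ffg H) I J \<phi> f) = ffg_map (map_ffg \<Gamma>) I J \<phi> (Theta \<Gamma> H \<rho> I f)"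
    if I: "I \<in> ffg_obj" and J: "J \<in> ffg_obj" and \<phi>: "\<phi> \<in> ffg_arr I J"
      and f: "f \<in> carrier (ffg_val (ad_ffg H) I)" for I J \<phi> f
  proof -
    have \<phi>h: "\<phi> \<in> hom (free_group I) (free_group J)" using \<phi> by (simp add: ffg_arr_def)
    have mp: "ffg_map (ad_ffg H) I J \<phi> f = (\<lambda>x\<in>J \<rightarrow>\<^sub>E carrier H. f (tuple_map H I \<phi> x))"
      using f unfolding val by (simp add: ad_ffg_def inv_fun_ffg_def)
    have "ffg_map (ad_ffg H) I J \<phi> f \<in> carrier (ffg_val (ad_ffg H) J)"
      using A.map[OF I J \<phi>] f by (auto simp: kalg_hom_def ring_hom_def)
    from th[OF J this] have "Theta \<Gamma> H \<rho> J (ffg_map (ad_ffg H) I J \<phi> f)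
        = (\<lambda>\<gamma>\<in>J \<rightarrow>\<^sub>E carrier \<Gamma>. f (tuple_map H I \<phi> (\<lambda>j\<in>J. \<rho> (\<gamma> j))))"
      using c[of _ J] by (simp only: mp) (auto intro!: restrict_ext)
    also have "\<dots> = (\<lambda>\<gamma>\<in>J \<rightarrow>\<^sub>E carrier \<Gamma>. Theta \<Gamma> H \<rho> I f (tuple_map \<Gamma> I \<phi> \<gamma>))"
      using \<Gamma>.tuple_map_closed[OF \<phi>h] nat[OF \<phi>] unfolding th[OF I f]
      by (intro restrict_ext) simp
    also have "\<dots> = ffg_map (map_ffg \<Gamma>) I J \<phi> (Theta \<Gamma> H \<rho> I f)"
    proof -
      have "Theta \<Gamma> H \<rho> I f \<in> extensional (I \<rightarrow>\<^sub>E carrier \<Gamma>)" "conj_invariant \<Gamma> I (Theta \<Gamma> H \<rho> I f)"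
        using inv f unfolding th[OF I f] by (simp_all add: val)
      then show ?thesis by (simp add: map_ffg_def inv_fun_ffg_def)
    qed
    finally show ?thesis .
  qed
  ultimately show ?thesis by (auto simp: ffg_hom_def Theta_def)
qed

lemma closedin_zariski:
  "closedin (zariski H) Z \<longleftrightarrow> (\<exists>S\<subseteq>regfuns H. Z = {x \<in> carrier H. \<forall>f\<in>S. f x = 0})"
proof -
  let ?D = "\<lambda>f :: 'h \<Rightarrow> 'k. {x \<in> carrier H. f x \<noteq> 0}"
  have one: "(\<lambda>x\<in>carrier H. 1) \<in> regfuns H"
    and mul: "\<And>f g. \<lbrakk>f \<in> regfuns H; g \<in> regfuns H\<rbrakk> \<Longrightarrow> (\<lambda>x\<in>carrier H. f x * g x) \<in> regfuns H"
    using fun_closed_regfuns unfolding fun_closed_def by blast+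
  have top: "topspace (zariski H) = carrier H"
  proof -
    have "carrier H = ?D (\<lambda>x\<in>carrier H. 1)" by auto
    then show ?thesis unfolding zariski_def topology_generated_by_topspace using one by blast
  qed
  have "openin (zariski H) U \<longleftrightarrow> (\<exists>S\<subseteq>regfuns H. U = \<Union>(?D ` S))" for U
  proof
    assume "openin (zariski H) U"
    then have "generate_topology_on (?D ` regfuns H) U"
      by (simp add: zariski_def openin_topology_generated_by_iff)
    then show "\<exists>S\<subseteq>regfuns H. U = \<Union>(?D ` S)"
    proof induction
      case (Int a b)
      from Int.IH(1) obtain S where S: "S \<subseteq> regfuns H \<and> a = \<Union>(?D ` S)" ..
      from Int.IH(2) obtain T where T: "T \<subseteq> regfuns H \<and> b = \<Union>(?D ` T)" ..
      let ?R = "(\<lambda>(f, g). \<lambda>x\<in>carrier H. f x * g x) ` (S \<times> T)"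
      have "?R \<subseteq> regfuns H" using S T mul by auto
      moreover have "a \<inter> b = \<Union>(?D ` ?R)"
      proof (rule Set.set_eqI)
        fix x
        have "x \<in> a \<inter> b \<longleftrightarrow> (\<exists>f\<in>S. \<exists>g\<in>T. x \<in> carrier H \<and> f x * g x \<noteq> 0)" using S T by auto
        also have "\<dots> \<longleftrightarrow> x \<in> \<Union>(?D ` ?R)" by auto
        finally show "x \<in> a \<inter> b \<longleftrightarrow> x \<in> \<Union>(?D ` ?R)" .
      qed
      ultimately show ?case by (intro exI conjI)
    next
      case (UN K)
      then have "\<forall>k\<in>K. \<exists>S. S \<subseteq> regfuns H \<and> k = \<Union>(?D ` S)" by blast
      then obtain S where S: "\<forall>k\<in>K. S k \<subseteq> regfuns H \<and> k = \<Union>(?D ` S k)" by (rule bchoice[THEN exE])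
      then have "\<Union>(S ` K) \<subseteq> regfuns H" "\<Union>K = \<Union>(?D ` \<Union>(S ` K))" by auto
      then show ?case by (intro exI conjI)
    next
      case (Basis s)
      then obtain f where "f \<in> regfuns H" "s = ?D f" by blast
      then show ?case by (intro exI[of _ "{f}"]) auto
    qed auto
  next
    assume "\<exists>S\<subseteq>regfuns H. U = \<Union>(?D ` S)"
    then show "openin (zariski H) U"
      unfolding zariski_def by (blast intro: openin_Union topology_generated_by_Basis)
  qed
  then have closed: "closedin (zariski H) Z \<longleftrightarrow> Z \<subseteq> carrier H \<and> (\<exists>S\<subseteq>regfuns H. carrier H - Z = \<Union>(?D ` S))"
    by (simp add: closedin_def top)
  have eq: "Z \<subseteq> carrier H \<and> carrier H - Z = \<Union>(?D ` S)
      \<longleftrightarrow> Z = {x \<in> carrier H. \<forall>f\<in>S. f x = 0}" for S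
  proof -
    have "\<Union>(?D ` S) = carrier H - {x \<in> carrier H. \<forall>f\<in>S. f x = 0}" by auto
    then show ?thesis by (metis (no_types, lifting) Diff_subset double_diff mem_Collect_eq subsetI subset_refl)
  qed
  show ?thesis unfolding closed eq[symmetric]
    by (rule iffI; elim exE conjE; intro exI conjI; assumption)
qed

end

end

(* Two morphisms of FFG-algebras agree on a sub-FFG-algebra, so they are equal once they agree on
   generators. For generators in k[H]^{Ad H}, which are class functions on H, element-conjugate
   representations therefore have the same Theta, and injectivity of rho |-> Theta_rho on
   conjugacy classes makes them globally conjugate. *)
theory Submission
  imports Defs
begin

text \<open>Homomorphisms carry every ring operation and scaling in \<open>M\<close> to the same one
  in \<open>N\<close>, so agreement at the arguments passes to the result. The ring part goes
  through \<open>ring_hom_ring\<close>; scaling is the extra condition in \<open>kalg_hom\<close>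
  and is treated separately.\<close>

lemma ksubalgebra_equalizer:
  fixes M :: "('k::field, 'a, 'm) module_scheme" and N :: "('k, 'b, 'n) module_scheme"
  assumes M: "algebra (base_algebra :: ('k, 'k) module) M"
    and N: "algebra (base_algebra :: ('k, 'k) module) N"
    and \<eta>: "\<eta> \<in> kalg_hom M N" and \<theta>: "\<theta> \<in> kalg_hom M N"
  shows "ksubalgebra {a \<in> carrier M. \<eta> a = \<theta> a} M"
proof -
  interpret M: algebra "base_algebra :: ('k, 'k) module" M by fact
  interpret N: algebra "base_algebra :: ('k, 'k) module" N by fact
  interpret \<eta>: ring_hom_ring M N \<eta>
    using \<eta> by (intro ring_hom_ringI2 M.ring_axioms N.ring_axioms) (simp add: kalg_hom_def)
  interpret \<theta>: ring_hom_ring M N \<theta>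
    using \<theta> by (intro ring_hom_ringI2 M.ring_axioms N.ring_axioms) (simp add: kalg_hom_def)
  have "subring {a \<in> carrier M. \<eta> a = \<theta> a} M"
    by (rule M.subringI) auto
  \<comment> \<open>The carrier of \<open>base_algebra\<close> is the whole type, so every
    \<open>c\<close> is an admissible scalar.\<close>
  moreover have "c \<odot>\<^bsub>M\<^esub> a \<in> carrier M" if "a \<in> carrier M" for c a
    using M.smult_closed[of c a] that by (simp add: base_algebra_def)
  moreover have "\<eta> (c \<odot>\<^bsub>M\<^esub> a) = c \<odot>\<^bsub>N\<^esub> \<eta> a" "\<theta> (c \<odot>\<^bsub>M\<^esub> a) = c \<odot>\<^bsub>N\<^esub> \<theta> a"
    if "a \<in> carrier M" for c a
    using \<eta> \<theta> that by (auto simp: kalg_hom_def)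
  ultimately show ?thesis by (auto simp: ksubalgebra_def)
qed

text \<open>At each object this is the equalizer of two algebra homomorphisms; stability under
  arrows is naturality, both images of \<open>ffg_map A I J \<phi> a\<close> being
  \<open>ffg_map B I J \<phi>\<close> of the common value at \<open>a\<close>.\<close>

lemma sub_ffg_algebra_equalizer:
  assumes A: "ffg_algebra A" and B: "ffg_algebra B"
    and \<eta>: "\<eta> \<in> ffg_hom A B" and \<theta>: "\<theta> \<in> ffg_hom A B"
  shows "sub_ffg_algebra (\<lambda>I. {a \<in> carrier (ffg_val A I). \<eta> I a = \<theta> I a}) A"
proof -
  interpret A: ffg_algebra A by fact
  interpret B: ffg_algebra B by fact
  have "ksubalgebra {a \<in> carrier (ffg_val A I). \<eta> I a = \<theta> I a} (ffg_val A I)"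
    if "I \<in> ffg_obj" for I
    using \<eta> \<theta> that by (intro ksubalgebra_equalizer[OF A.val B.val]) (auto simp: ffg_hom_def)
  moreover have "ffg_map A I J \<phi> a \<in> carrier (ffg_val A J)"
    and "\<eta> J (ffg_map A I J \<phi> a) = ffg_map B I J \<phi> (\<eta> I a)"
    and "\<theta> J (ffg_map A I J \<phi> a) = ffg_map B I J \<phi> (\<theta> I a)"
    if "I \<in> ffg_obj" "J \<in> ffg_obj" "\<phi> \<in> ffg_arr I J" "a \<in> carrier (ffg_val A I)" for I J \<phi> a
    using A.map[OF that(1-3)] \<eta> \<theta> that by (auto simp: ffg_hom_def kalg_hom_def ring_hom_def)
  ultimately show ?thesis by (auto simp: sub_ffg_algebra_def)
qed

lemma ffg_hom_eq_if_eq_on_generators: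
  assumes "ffg_algebra A" "ffg_algebra B"
    and \<eta>: "\<eta> \<in> ffg_hom A B" and \<theta>: "\<theta> \<in> ffg_hom A B"
    and gen: "ffg_generated_by A \<Sigma>"
    and eq: "\<And>I a. (I, a) \<in> \<Sigma> \<Longrightarrow> \<eta> I a = \<theta> I a"
  shows "\<eta> = \<theta>"
proof -
  let ?S = "\<lambda>I. {a \<in> carrier (ffg_val A I). \<eta> I a = \<theta> I a}"
  have "\<Sigma> \<subseteq> (SIGMA I:ffg_obj. ?S I)"
    using gen eq by (auto simp: ffg_generated_by_def)
  \<comment> \<open>The minimality clause of generation, applied to the equalizer.\<close>
  then have all: "?S I = carrier (ffg_val A I)" if "I \<in> ffg_obj" for I
    using gen sub_ffg_algebra_equalizer[OF assms(1-4)] that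
    unfolding ffg_generated_by_def by meson
  \<comment> \<open>Agreement on carriers becomes equality of functions: morphisms are
    \<open>undefined\<close> off the carriers and off \<open>ffg_obj\<close>.\<close>
  have "\<eta> I = \<theta> I" if I: "I \<in> ffg_obj" for I
  proof (rule extensionalityI)
    show "\<eta> I \<in> extensional (carrier (ffg_val A I))" "\<theta> I \<in> extensional (carrier (ffg_val A I))"
      using \<eta> \<theta> I by (auto simp: ffg_hom_def kalg_hom_def)
    show "\<eta> I a = \<theta> I a" if "a \<in> carrier (ffg_val A I)" for a
      using all[OF I] that by blast
  qed
  moreover have "\<eta> \<in> extensional ffg_obj" "\<theta> \<in> extensional ffg_obj"
    using \<eta> \<theta> by (auto simp: ffg_hom_def)
  ultimately show ?thesis by (intro extensionalityI[of _ ffg_obj])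
qed

text \<open>A one-element tuple has a single entry, so a conjugator that depends on this entry
  already conjugates the whole tuple. Longer tuples would call for one conjugator common to all
  entries, which element-conjugacy does not supply.\<close>

lemma Theta_singleton_eq_if_element_conjugate:
  assumes \<rho>: "\<rho>\<^sub>2 \<in> carrier \<Gamma> \<rightarrow> carrier H"
    and conj: "element_conjugate \<Gamma> H \<rho>\<^sub>1 \<rho>\<^sub>2"
    and f: "f \<in> carrier (ffg_val (ad_ffg H) {j})"
  shows "Theta \<Gamma> H \<rho>\<^sub>1 {j} f = Theta \<Gamma> H \<rho>\<^sub>2 {j} f"
proof -
  have inv: "conj_invariant H {j} f"
    using f by (simp add: ad_ffg_def inv_fun_ffg_def fun_algebra_def)
  have "f (\<lambda>i\<in>{j}. \<rho>\<^sub>1 (\<gamma> i)) = f (\<lambda>i\<in>{j}. \<rho>\<^sub>2 (\<gamma> i))" if \<gamma>: "\<gamma> \<in> {j} \<rightarrow>\<^sub>E carrier \<Gamma>" for \<gamma>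
  proof -
    have \<gamma>j: "\<gamma> j \<in> carrier \<Gamma>" using \<gamma> by auto
    then obtain h where h: "h \<in> carrier H"
      "\<rho>\<^sub>1 (\<gamma> j) = h \<otimes>\<^bsub>H\<^esub> \<rho>\<^sub>2 (\<gamma> j) \<otimes>\<^bsub>H\<^esub> inv\<^bsub>H\<^esub> h"
      using conj unfolding element_conjugate_def by blast
    let ?x = "\<lambda>i\<in>{j}. \<rho>\<^sub>2 (\<gamma> i)"
    \<comment> \<open>Invariance of \<open>f\<close> is only asserted at points of the power of
      \<open>carrier H\<close>; this is where the assumption on \<open>\<rho>\<^sub>2\<close>
      enters.\<close>
    have "?x \<in> {j} \<rightarrow>\<^sub>E carrier H" using \<rho> \<gamma>j by auto
    then have "f (\<lambda>i\<in>{j}. h \<otimes>\<^bsub>H\<^esub> ?x i \<otimes>\<^bsub>H\<^esub> inv\<^bsub>H\<^esub> h) = f ?x"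
      using inv h(1) unfolding conj_invariant_def by blast
    moreover have "(\<lambda>i\<in>{j}. h \<otimes>\<^bsub>H\<^esub> ?x i \<otimes>\<^bsub>H\<^esub> inv\<^bsub>H\<^esub> h) = (\<lambda>i\<in>{j}. \<rho>\<^sub>1 (\<gamma> i))"
      using h(2) by (intro restrict_ext) simp
    ultimately show ?thesis by simp
  qed
  then show ?thesis
    using f by (simp add: Theta_def ffg_obj_def cong: restrict_cong)
qed

text \<open>The correspondence is encoded by a bijection \<open>F\<close> on classes whose value is
  \<open>Theta\<close> of any representative, and \<open>{1}\<close> serves as the one-element index
  set. Hypothesis and conclusion range over groups on the same type \<open>'g\<close>, so the
  correspondence is available for each group to be tested.\<close>

theorem theorem4p3:
  fixes H :: "('h, 'k::{alg_closed_field, field_char_0}) alg_group"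
  assumes "affine_alg_group H"
    and "\<forall>\<Gamma> :: 'g monoid. group \<Gamma> \<longrightarrow>
      (\<exists>F. bij_betw F (semisimple_classes \<Gamma> H) (ffg_hom (ad_ffg H) (map_ffg \<Gamma>)) \<and>
           (\<forall>C\<in>semisimple_classes \<Gamma> H. \<forall>\<rho>\<in>C. F C = Theta \<Gamma> H \<rho>))"
    and "ffg_generated_by (ad_ffg H) ({{1}} \<times> carrier (ffg_val (ad_ffg H) {1}))"
  shows "acceptable TYPE('g) H"
  unfolding acceptable_def
proof (intro allI ballI impI)
  interpret H: affine_alg_group H by fact
  fix \<Gamma> :: "'g monoid" and \<rho>\<^sub>1 \<rho>\<^sub>2
  assume \<Gamma>: "group \<Gamma>" and \<rho>\<^sub>1: "\<rho>\<^sub>1 \<in> semisimple_reps \<Gamma> H" and \<rho>\<^sub>2: "\<rho>\<^sub>2 \<in> semisimple_reps \<Gamma> H"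
    and conj: "element_conjugate \<Gamma> H \<rho>\<^sub>1 \<rho>\<^sub>2"
  have hom: "\<rho> \<in> hom \<Gamma> H" if "\<rho> \<in> semisimple_reps \<Gamma> H" for \<rho>
    using that by (simp add: semisimple_reps_def)
  have Theta_eq: "Theta \<Gamma> H \<rho>\<^sub>1 = Theta \<Gamma> H \<rho>\<^sub>2"
  proof (rule ffg_hom_eq_if_eq_on_generators[OF H.ffg_algebra_ad_ffg ffg_algebra_map_ffg[OF \<Gamma>]
        H.Theta_ffg_hom[OF \<Gamma> hom[OF \<rho>\<^sub>1]] H.Theta_ffg_hom[OF \<Gamma> hom[OF \<rho>\<^sub>2]] assms(3)])
    show "Theta \<Gamma> H \<rho>\<^sub>1 I f = Theta \<Gamma> H \<rho>\<^sub>2 I f"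
      if "(I, f) \<in> {{1}} \<times> carrier (ffg_val (ad_ffg H) {1})" for I f
      using that hom[OF \<rho>\<^sub>2] conj
      by (auto simp: hom_def intro!: Theta_singleton_eq_if_element_conjugate)
  qed
  let ?R = "{(\<rho>\<^sub>1, \<rho>\<^sub>2). \<rho>\<^sub>1 \<in> semisimple_reps \<Gamma> H \<and> \<rho>\<^sub>2 \<in> semisimple_reps \<Gamma> H \<and>
    globally_conjugate \<Gamma> H \<rho>\<^sub>1 \<rho>\<^sub>2}"
  \<comment> \<open>Conjugation by the identity puts each representation in its own class, so
    \<open>F\<close> can be evaluated there through it.\<close>
  have refl: "\<rho> \<in> ?R `` {\<rho>}" if "\<rho> \<in> semisimple_reps \<Gamma> H" for \<rho>
    using that hom[OF that]
    by (auto simp: globally_conjugate_def hom_def Pi_iff intro!: bexI[of _ "\<one>\<^bsub>H\<^esub>"])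
  have cls: "?R `` {\<rho>} \<in> semisimple_classes \<Gamma> H" if "\<rho> \<in> semisimple_reps \<Gamma> H" for \<rho>
    unfolding semisimple_classes_def using that by (rule quotientI)
  obtain F where inj: "inj_on F (semisimple_classes \<Gamma> H)"
    and F: "\<And>C \<rho>. C \<in> semisimple_classes \<Gamma> H \<Longrightarrow> \<rho> \<in> C \<Longrightarrow> F C = Theta \<Gamma> H \<rho>"
    using assms(2) \<Gamma> unfolding bij_betw_def by meson
  have "F (?R `` {\<rho>\<^sub>1}) = F (?R `` {\<rho>\<^sub>2})"
    using F[OF cls refl, OF \<rho>\<^sub>1 \<rho>\<^sub>1] F[OF cls refl, OF \<rho>\<^sub>2 \<rho>\<^sub>2] Theta_eq by simp
  then have "?R `` {\<rho>\<^sub>1} = ?R `` {\<rho>\<^sub>2}"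
    using inj cls[OF \<rho>\<^sub>1] cls[OF \<rho>\<^sub>2] by (meson inj_onD)
  \<comment> \<open>Membership in the class of \<open>\<rho>\<^sub>1\<close> unfolds to the pair
    \<open>(\<rho>\<^sub>1, \<rho>\<^sub>2)\<close> in \<open>?R\<close>, in the orientation of the
    goal.\<close>
  then have "\<rho>\<^sub>2 \<in> ?R `` {\<rho>\<^sub>1}" using refl[OF \<rho>\<^sub>2] by simp
  then show "globally_conjugate \<Gamma> H \<rho>\<^sub>1 \<rho>\<^sub>2" by simp
qed

end
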